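(* For every $n\ge 1$, the asymptotic $n$-point function satisfies $$A(x_1,\dots,x_n)=e^{-\frac{h}{2}\left(\sum_i x_i\right)^2}\sum_{\alpha\in\Pi_n}h^{-\ell(\alpha)}\,\mathcal{S}_\alpha(x_1,\dots,x_n),$$ where the summation is over all partitions $\alpha$ of the set $\{1,\dots,n\}$.
   Context: Asymptotic $n$-point function. Let $h$ be a parameter and put $g(x)=\sin(\pi x)\,e^{hx^2/2}$. Then $A(x_1,\dots,x_n)$ is the meromorphic function $$A(x_1,\dots,x_n)=\sum_{w\in S_n}\frac{\det\left[\dfrac{h^{-(j-i+1)}\,g^{(j-i+1)}\big(x_{w(1)}+\dots+x_{w(n-j)}\big)}{(j-i+1)!}\right]_{i,j=1}^n}{g(x_{w(1)})\,g(x_{w(1)}+x_{w(2)})\cdots g(x_{w(1)}+\dots+x_{w(n)})},$$ where $g^{(k)}$ is the $k$-th derivative of $g$ with respect to its argument, entries with $j-i+1<0$ are zero, and for $j=n$ the argument is $0$ (empty sum). (This is the result of substituting $\vartheta(hx)\mapsto g(x)$, $\vartheta^{(k)}(hx)\mapsto h^{-k}g^{(k)}(x)$ in the formula for the $n$-point function $F(hx_1,\dots,hx_n)$ as a sum over permutations of determinants of theta functions $\vartheta$ and their derivatives.) $\Pi_n$ is the set of all set partitions of $\{1,\dots,n\}$ into nonempty unordered blocks $\alpha_1,\dots,\alpha_{\ell(\alpha)}$; $\ell(\alpha)$ is the number of blocks. Define $$\mathcal{S}(x_1,\dots,x_k)=\frac{\pi\,(x_1+\cdots+x_k)^{k-1}}{\sin(\pi(x_1+\cdots+x_k))},\qquad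 \mathcal{S}_\alpha(x_1,\dots,x_n)=\prod_{k=1}^{\ell(\alpha)}\mathcal{S}(x_{\alpha_k}),$$ where $x_{\alpha_k}=\{x_i\}_{i\in\alpha_k}$. *)

theory Defs
  imports
    "HOL-Complex_Analysis.Complex_Analysis"
    "HOL-Library.Disjoint_Sets"
    "HOL-Combinatorics.Permutations"
    "Jordan_Normal_Form.Determinant"
begin

text \<open>
  The variables \<open>x\<^sub>1, \<dots>, x\<^sub>n\<close> are the values \<open>x 1, \<dots>, x n\<close> of a function
  \<open>x :: nat \<Rightarrow> complex\<close>; the remaining values of \<open>x\<close> are irrelevant.
\<close>

definition g :: "complex \<Rightarrow> complex \<Rightarrow> complex" where
  "g h z = sin (of_real pi * z) * exp (h * z\<^sup>2 / 2)"

definition scaled_taylor_coeff :: "complex \<Rightarrow> nat \<Rightarrow> complex \<Rightarrow> complex" where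
  "scaled_taylor_coeff h k z = (h powi (- int k) * (deriv ^^ k) (g h) z) / fact k"

text \<open>
  Row and column indices of type \<open>mat\<close> start at 0, so the entry at \<open>(i, j)\<close> below is the
  entry at \<open>(i + 1, j + 1)\<close> in the usual numbering: \<open>j - i + 1\<close> is unaffected by the shift, and
  the argument \<open>x\<^bsub>w(1)\<^esub> + \<dots> + x\<^bsub>w(n-j)\<^esub>\<close> is summed up to \<open>n - (j + 1)\<close>, where the natural
  number subtraction does not truncate because \<open>j < n\<close>.
\<close>

definition A_matrix :: "complex \<Rightarrow> nat \<Rightarrow> (nat \<Rightarrow> complex) \<Rightarrow> (nat \<Rightarrow> nat) \<Rightarrow> complex mat" where
  "A_matrix h n x w =
     mat n n (\<lambda>(i, j).
       if j + 1 < i then 0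
       else scaled_taylor_coeff h (j + 1 - i) (\<Sum>m = 1..n - (j + 1). x (w m)))"

text \<open>
  This is the meromorphic function \<open>A\<close> at all points where no denominator vanishes, that is,
  where no sum of the \<open>x\<^sub>i\<close> over a nonempty set of indices is an integer. Elsewhere the value is
  an artefact of division by zero.
\<close>

definition A_fun :: "complex \<Rightarrow> nat \<Rightarrow> (nat \<Rightarrow> complex) \<Rightarrow> complex" where
  "A_fun h n x =
     (\<Sum>w | w permutes {1..n}.
        Determinant.det (A_matrix h n x w) / (\<Prod>k = 1..n. g h (\<Sum>m = 1..k. x (w m))))"

definition S_block :: "(nat \<Rightarrow> complex) \<Rightarrow> nat set \<Rightarrow> complex" where
  "S_block x B =
     of_real pi * (\<Sum>i\<in>B. x i) ^ (card B - 1) / sin (of_real pi * (\<Sum>i\<in>B. x i))"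

definition S_part :: "(nat \<Rightarrow> complex) \<Rightarrow> nat set set \<Rightarrow> complex" where
  "S_part x \<alpha> = (\<Prod>B\<in>\<alpha>. S_block x B)"

end

theory Submission
  imports Defs "HOL-Combinatorics.Multiset_Permutations"
begin

text \<open>
  The determinant is of Hessenberg type, so its quotient by the product of the subdiagonal entries
  and \<open>g(x\<^sub>1 + \<dots> + x\<^sub>n)\<close> satisfies a linear recursion along the sequence of partial
  sums. Summing this recursion over all orderings of the variables gives, for the symmetrised
  function \<open>R\<close> of a set of variables and every nonempty \<open>N\<close>, with
  \<open>x\<^sub>L = (\<Sum>i\<in>L. x i)\<close>,
  \<open>(\<Sum>L\<subseteq>N. (-1)\<^bsup>|N-L|\<^esup> h\<^bsup>-|N-L|\<^esup> g\<^bsup>(|N-L|)\<^esup>(x\<^sub>L) R(L)) = 0\<close>,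
  which determines \<open>R\<close> from \<open>R({}) = 1\<close>. It remains to see that the right-hand side of
  the theorem satisfies it. Put \<open>c = \<i>\<pi>/h\<close>. Completing the square, \<open>h\<^bsup>-k\<^esup> g\<^bsup>(k)\<^esup>(z)\<close> is
  \<open>exp(hz\<^sup>2/2)/2\<i>\<close> times \<open>exp(\<i>\<pi>z) H\<^sub>k(z+c) - exp(-\<i>\<pi>z) H\<^sub>k(z-c)\<close>,
  with the Hermite polynomials \<open>H\<^sub>k\<close> of variance \<open>1/h\<close>. Multiplying a sum over set partitions of \<open>L\<close> by
  \<open>exp(\<plusminus>\<i>\<pi>x\<^sub>L)\<close> multiplies the weight of each block \<open>B\<close> by
  \<open>exp(\<plusminus>\<i>\<pi>x\<^sub>B)\<close>, and for the blocks \<open>S(x\<^sub>B)/h\<close> the two results differ by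
  \<open>2c x\<^sub>B\<^bsup>|B|-1\<^esup>\<close>. The sums over partitions with these weights are the Abel polynomials
  \<open>a (a + x\<^sub>M)\<^bsup>|M|-1\<^esup>\<close> at \<open>a = 2c\<close>, and Hurwitz' form of Abel's identity, applied to the
  Appell sequence \<open>H\<^sub>k\<close>, shifts the argument \<open>z + c\<close> to \<open>z - c\<close>, so both halves cancel.
\<close>

subsection \<open>Hurwitz' form of Abel's identity\<close>

text \<open>A chain \<open>M\<close> inside \<open>L\<close> inside \<open>N\<close> amounts to two
  disjoint subsets of \<open>N\<close>, namely \<open>M\<close> and
  \<open>K = L - M\<close>.\<close>

lemma sum_Pow_Pow_diff:
  fixes F :: "'a set \<Rightarrow> 'a set \<Rightarrow> 'b::comm_monoid_add"
  assumes "finite N"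
  shows "(\<Sum>L\<in>Pow N. \<Sum>M\<in>Pow L. F M (L - M)) = (\<Sum>K\<in>Pow N. \<Sum>M\<in>Pow (N - K). F M K)"
proof -
  have fin: "finite L" if "L \<subseteq> N" for L
    using assms that finite_subset by blast
  have "(\<Sum>L\<in>Pow N. \<Sum>M\<in>Pow L. F M (L - M)) = (\<Sum>(L, M)\<in>(SIGMA L:Pow N. Pow L). F M (L - M))"
    using fin by (intro sum.Sigma) (auto simp: assms)
  also have "\<dots> = (\<Sum>(K, M)\<in>(SIGMA K:Pow N. Pow (N - K)). F M K)"
    by (rule sum.reindex_bij_witness[of _ "\<lambda>(K, M). (K \<union> M, M)" "\<lambda>(L, M). (L - M, M)"]) auto
  also have "\<dots> = (\<Sum>K\<in>Pow N. \<Sum>M\<in>Pow (N - K). F M K)"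
    using assms by (intro sum.Sigma[symmetric]) auto
  finally show ?thesis .
qed

text \<open>A subset with a marked element can be chosen mark first; this regroups the derivatives
  in \<open>abel_hurwitz\<close>.\<close>

lemma sum_Pow_elem:
  fixes F :: "'a \<Rightarrow> 'a set \<Rightarrow> 'b::comm_monoid_add"
  assumes "finite P"
  shows "(\<Sum>M\<in>Pow P. \<Sum>j\<in>M. F j (M - {j})) = (\<Sum>j\<in>P. \<Sum>M\<in>Pow (P - {j}). F j M)"
proof -
  have fin: "finite L" if "L \<subseteq> P" for L
    using assms that finite_subset by blast
  have "(\<Sum>M\<in>Pow P. \<Sum>j\<in>M. F j (M - {j})) = (\<Sum>(M, j)\<in>(SIGMA M:Pow P. M). F j (M - {j}))"
    using fin by (intro sum.Sigma) (auto simp: assms)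
  also have "\<dots> = (\<Sum>(j, M)\<in>(SIGMA j:P. Pow (P - {j})). F j M)"
    by (rule sum.reindex_bij_witness[of _ "\<lambda>(j, M). (insert j M, j)" "\<lambda>(M, j). (j, M - {j})"]) auto
  also have "\<dots> = (\<Sum>j\<in>P. \<Sum>M\<in>Pow (P - {j}). F j M)"
    using assms by (intro sum.Sigma[symmetric]) auto
  finally show ?thesis .
qed

text \<open>The Abel polynomial of a set of variables. For empty \<open>M\<close> it should be
  \<open>a * a^(-1) = 1\<close>, but the truncated exponent \<open>card M - 1\<close> would give
  \<open>a\<close>; hence the separate case.\<close>

definition hurwitz :: "('a \<Rightarrow> complex) \<Rightarrow> 'a set \<Rightarrow> complex \<Rightarrow> complex" where
  "hurwitz x M a = (if M = {} then 1 else a * (a + sum x M) ^ (card M - 1))"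

lemma hurwitz_empty [simp]: "hurwitz x {} a = 1"
  by (simp add: hurwitz_def)

lemma hurwitz_zero [simp]: "M \<noteq> {} \<Longrightarrow> hurwitz x M 0 = 0"
  by (simp add: hurwitz_def)

text \<open>Moving \<open>x j\<close> into the argument leaves the base \<open>a + sum x M\<close>
  unchanged, so the linear factors \<open>a + x j\<close> add up to the one that the product rule
  produces.\<close>

lemma hurwitz_has_field_derivative:
  assumes "finite M"
  shows "(hurwitz x M has_field_derivative (\<Sum>j\<in>M. hurwitz x (M - {j}) (a + x j))) (at a)"
proof (cases "card M \<le> 1")
  case True
  then consider "M = {}" | j where "M = {j}"
    using assms by (metis card_0_eq card_1_singletonE le_eq_less_or_eq less_one)
  then show ?thesis
    by cases (auto simp: hurwitz_def[abs_def])
next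
  case False
  then obtain m where m: "card M = Suc (Suc m)"
    by (metis Suc_leI not_less_eq_eq One_nat_def Suc_le_D not_le)
  have ne: "M - {j} \<noteq> {}" if "j \<in> M" for j
    using m that assms by (metis card_Diff_singleton card.empty diff_Suc_1 nat.distinct(1))
  have "hurwitz x (M - {j}) (a + x j) = (a + x j) * (a + sum x M) ^ m" if "j \<in> M" for j
    using ne[OF that] that assms m by (simp add: hurwitz_def sum_diff1 card_Diff_singleton)
  then have "(\<Sum>j\<in>M. hurwitz x (M - {j}) (a + x j))
      = (of_nat (Suc (Suc m)) * a + sum x M) * (a + sum x M) ^ m"
    using m by (simp add: sum_distrib_right[symmetric] sum.distrib)
  moreover have "hurwitz x M = (\<lambda>a. a * (a + sum x M) ^ Suc m)"
    using m by (cases "M = {}") (auto simp: hurwitz_def[abs_def])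
  moreover have "((\<lambda>a. a * (a + sum x M) ^ Suc m) has_field_derivative
      (of_nat (Suc (Suc m)) * a + sum x M) * (a + sum x M) ^ m) (at a)"
  proof -
    have "((\<lambda>a. (a + sum x M) ^ Suc m) has_field_derivative of_nat (Suc m) * (a + sum x M) ^ m) (at a)"
      by (rule DERIV_cong[OF DERIV_power[OF DERIV_add[OF DERIV_ident DERIV_const]]]) simp
    from DERIV_mult[OF DERIV_ident this] show ?thesis
      by (simp add: algebra_simps)
  qed
  ultimately show ?thesis by simp
qed

text \<open>Appell sequences in the normalisation of the monomials. At \<open>k = 0\<close> the
  truncated \<open>k - 1\<close> is harmless because its factor is 0.\<close>

definition appell :: "(nat \<Rightarrow> complex \<Rightarrow> complex) \<Rightarrow> bool" where
  "appell f \<longleftrightarrow> (\<forall>k z. (f k has_field_derivative of_nat k * f (k - 1) z) (at z))"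

text \<open>Differentiation in \<open>a\<close> turns both sides into sums over \<open>j\<close> of
  the identity for \<open>P - {j}\<close>. By induction their difference is constant in
  \<open>a\<close>, and it vanishes at \<open>a = 0\<close>.\<close>

lemma abel_hurwitz:
  fixes x :: "'a \<Rightarrow> complex"
  assumes "finite P" and f: "appell f"
  shows "(\<Sum>M\<in>Pow P. hurwitz x M a * f (card (P - M)) (b - sum x M)) = f (card P) (b + a)"
  using \<open>finite P\<close>
proof (induction P arbitrary: a b rule: finite_psubset_induct)
  case (psubset P)
  have fin: "finite M" if "M \<subseteq> P" for M
    using psubset.hyps that finite_subset by blast
  define D where "D a = (\<Sum>M\<in>Pow P. hurwitz x M a * f (card (P - M)) (b - sum x M))
    - f (card P) (b + a)" for a
  have "(D has_field_derivative 0) (at a)" for a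
  proof -
    have f1: "((\<lambda>a. f (card P) (b + a)) has_field_derivative
        of_nat (card P) * f (card P - 1) (b + a)) (at a)"
    proof -
      have "((\<lambda>a. f (card P) (b + a)) has_field_derivative
          of_nat (card P) * f (card P - 1) (b + a) * 1) (at a)"
      proof (rule DERIV_chain2[where f = "f (card P)" and g = "\<lambda>a. b + a"])
        show "(f (card P) has_field_derivative of_nat (card P) * f (card P - 1) (b + a)) (at (b + a))"
          using f by (simp add: appell_def)
      qed (auto intro!: derivative_eq_intros)
      then show ?thesis by simp
    qed
    have "(D has_field_derivative
      (\<Sum>M\<in>Pow P. (\<Sum>j\<in>M. hurwitz x (M - {j}) (a + x j)) * f (card (P - M)) (b - sum x M))
      - of_nat (card P) * f (card P - 1) (b + a)) (at a)"
      unfolding D_def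
      by (intro DERIV_diff f1 DERIV_sum DERIV_cmult_right hurwitz_has_field_derivative) (auto intro: fin)
    also have "(\<Sum>M\<in>Pow P. (\<Sum>j\<in>M. hurwitz x (M - {j}) (a + x j)) * f (card (P - M)) (b - sum x M))
      = (\<Sum>M\<in>Pow P. \<Sum>j\<in>M. hurwitz x (M - {j}) (a + x j) *
           f (card (P - {j} - (M - {j}))) ((b - x j) - sum x (M - {j})))"
      unfolding sum_distrib_right
    proof (intro sum.cong refl)
      fix M j assume "M \<in> Pow P" "j \<in> M"
      then have "P - {j} - (M - {j}) = P - M" "sum x (M - {j}) = sum x M - x j"
        using fin[of M] by (auto simp: sum_diff1)
      then show "hurwitz x (M - {j}) (a + x j) * f (card (P - M)) (b - sum x M) =
        hurwitz x (M - {j}) (a + x j) * f (card (P - {j} - (M - {j}))) (b - x j - sum x (M - {j}))"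
        by simp
    qed
    also have "\<dots> = (\<Sum>j\<in>P. \<Sum>M\<in>Pow (P - {j}). hurwitz x M (a + x j) *
           f (card (P - {j} - M)) ((b - x j) - sum x M))"
      by (rule sum_Pow_elem[OF psubset.hyps])
    \<comment> \<open>The induction hypothesis is used at \<open>a + x j\<close> and
      \<open>b - x j\<close>, whose sum is again \<open>b + a\<close>.\<close>
    also have "\<dots> = (\<Sum>j\<in>P. f (card P - 1) (b + a))"
    proof (intro sum.cong refl)
      fix j assume "j \<in> P"
      then show "(\<Sum>M\<in>Pow (P - {j}). hurwitz x M (a + x j) *
           f (card (P - {j} - M)) ((b - x j) - sum x M)) = f (card P - 1) (b + a)"
        by (subst psubset.IH) (auto simp: algebra_simps)
    qed
    finally show ?thesis by simp
  qed
  then obtain C where C: "D a = C" for a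
    using has_field_derivative_zero_constant[of UNIV D] by auto
  \<comment> \<open>At \<open>a = 0\<close> the factor \<open>a\<close> removes every nonempty
    \<open>M\<close>.\<close>
  have "D 0 = (\<Sum>M\<in>{{}}. hurwitz x M 0 * f (card (P - M)) (b - sum x M)) - f (card P) b"
    unfolding D_def using psubset.hyps
    by (intro arg_cong2[where f = minus] sum.mono_neutral_right) auto
  then have "D a = 0"
    using C[of a] C[of 0] by simp
  then show ?case by (simp add: D_def)
qed

subsection \<open>Sums over set partitions\<close>

definition partition_sum :: "('a set \<Rightarrow> complex) \<Rightarrow> 'a set \<Rightarrow> complex" where
  "partition_sum f A = (\<Sum>\<alpha> | partition_on A \<alpha>. \<Prod>B\<in>\<alpha>. f B)"

lemma partition_sum_empty [simp]: "partition_sum f {} = 1"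
  by (simp add: partition_sum_def partition_on_empty)

lemma partition_sum_cong:
  assumes "\<And>B. B \<subseteq> N \<Longrightarrow> B \<noteq> {} \<Longrightarrow> f B = k B"
  shows "partition_sum f N = partition_sum k N"
  unfolding partition_sum_def
proof (intro sum.cong prod.cong refl)
  fix \<alpha> B assume "\<alpha> \<in> {\<alpha>. partition_on N \<alpha>}" "B \<in> \<alpha>"
  then show "f B = k B"
    using assms[of B] by (auto dest: partition_onD1 partition_onD3)
qed

text \<open>Partitions are sorted by the block \<open>insert m C\<close> that contains
  \<open>m\<close>; the other blocks partition \<open>P - C\<close>.\<close>

lemma partition_sum_insert:
  assumes "finite P" "m \<notin> P"
  shows "partition_sum f (insert m P) = (\<Sum>C\<in>Pow P. f (insert m C) * partition_sum f (P - C))"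
proof -
  \<comment> \<open>The block containing \<open>m\<close>, unique by disjointness.
    \<open>ins\<close> and \<open>rem\<close> show that inserting and removing it lead to partitions
    again.\<close>
  let ?b = "\<lambda>\<alpha>. THE B. B \<in> \<alpha> \<and> m \<in> B"
  have b: "?b \<alpha> = B" if "partition_on A \<alpha>" "B \<in> \<alpha>" "m \<in> B" for A \<alpha> B
    using that partition_onD2[OF that(1)] unfolding disjoint_def
    by (intro the_equality conjI) (simp_all, blast)
  have ins: "partition_on (insert m P) (insert (insert m C) \<gamma>) \<and> insert m C \<notin> \<gamma>"
    if "C \<subseteq> P" "partition_on (P - C) \<gamma>" for C \<gamma>
  proof -
    have "\<Union>\<gamma> = P - C" using that(2) by (simp add: partition_onD1[symmetric])
    then have "disjnt (insert m C) (\<Union>\<gamma>)" "insert m P - insert m C = P - C"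
      using assms(2) that(1) by (auto simp: disjnt_def)
    then show ?thesis using that assms(2) \<open>\<Union>\<gamma> = P - C\<close>
      by (auto simp: partition_on_insert)
  qed
  have rem: "\<exists>B. B \<in> \<alpha> \<and> m \<in> B \<and> B \<subseteq> insert m P \<and> partition_on (P - (B - {m})) (\<alpha> - {B})"
    if \<alpha>: "partition_on (insert m P) \<alpha>" for \<alpha>
  proof -
    obtain B where B: "B \<in> \<alpha>" "m \<in> B"
      using partition_onD1[OF \<alpha>] by auto
    have "disjnt B (\<Union>(\<alpha> - {B}))"
      using partition_onD2[OF \<alpha>] B by (auto simp: disjoint_def disjnt_def)
    then have "partition_on (insert m P - B) (\<alpha> - {B})"
      using partition_on_insert[of B "\<alpha> - {B}" "insert m P"] \<alpha> B by (simp add: insert_absorb)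
    moreover have "insert m P - B = P - (B - {m})" using B assms by auto
    moreover have "B \<subseteq> insert m P" using partition_onD1[OF \<alpha>] B by auto
    ultimately show ?thesis using B by auto
  qed
  have "(\<Sum>C\<in>Pow P. f (insert m C) * partition_sum f (P - C))
    = (\<Sum>C\<in>Pow P. \<Sum>\<gamma> | partition_on (P - C) \<gamma>. f (insert m C) * (\<Prod>B\<in>\<gamma>. f B))"
    by (simp add: partition_sum_def sum_distrib_left)
  also have "\<dots> = (\<Sum>(C, \<gamma>)\<in>(SIGMA C:Pow P. {\<gamma>. partition_on (P - C) \<gamma>}). f (insert m C) * (\<Prod>B\<in>\<gamma>. f B))"
    using assms by (intro sum.Sigma) (auto intro: finitely_many_partition_on)
  also have "\<dots> = partition_sum f (insert m P)"
    unfolding partition_sum_def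
  proof (rule sum.reindex_bij_witness[of _ "\<lambda>\<alpha>. (?b \<alpha> - {m}, \<alpha> - {?b \<alpha>})"
        "\<lambda>(C, \<gamma>). insert (insert m C) \<gamma>"])
    fix p assume p: "p \<in> (SIGMA C:Pow P. {\<gamma>. partition_on (P - C) \<gamma>})"
    then obtain C \<gamma> where [simp]: "p = (C, \<gamma>)" and C: "C \<subseteq> P" "partition_on (P - C) \<gamma>" by auto
    have "?b (insert (insert m C) \<gamma>) = insert m C"
      using ins[OF C] by (intro b) auto
    then have [simp]: "(THE B. (B = insert m C \<or> B \<in> \<gamma>) \<and> m \<in> B) = insert m C" by simp
    have "m \<notin> C" using C assms by auto
    then show "(?b (case p of (C, \<gamma>) \<Rightarrow> insert (insert m C) \<gamma>) - {m},
        (case p of (C, \<gamma>) \<Rightarrow> insert (insert m C) \<gamma>) - {?b (case p of (C, \<gamma>) \<Rightarrow> insert (insert m C) \<gamma>)}) = p"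
      using ins[OF C] by auto
    show "(case p of (C, \<gamma>) \<Rightarrow> insert (insert m C) \<gamma>) \<in> {\<alpha>. partition_on (insert m P) \<alpha>}"
      using ins[OF C] by auto
    have "finite \<gamma>" using C(2) assms(1) by (auto intro: finite_elements)
    then show "prod f (case p of (C, \<gamma>) \<Rightarrow> insert (insert m C) \<gamma>) =
        (case p of (C, \<gamma>) \<Rightarrow> f (insert m C) * prod f \<gamma>)"
      using ins[OF C] by auto
  next
    fix \<alpha> assume "\<alpha> \<in> {\<alpha>. partition_on (insert m P) \<alpha>}"
    then have \<alpha>: "partition_on (insert m P) \<alpha>" by simp
    then obtain B where B: "B \<in> \<alpha>" "m \<in> B" "B \<subseteq> insert m P"
      "partition_on (P - (B - {m})) (\<alpha> - {B})"
      using rem by blast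
    have [simp]: "?b \<alpha> = B" using b[OF \<alpha>] B by auto
    show "(case (?b \<alpha> - {m}, \<alpha> - {?b \<alpha>}) of (C, \<gamma>) \<Rightarrow> insert (insert m C) \<gamma>) = \<alpha>"
      using B by (auto simp: insert_absorb)
    show "(?b \<alpha> - {m}, \<alpha> - {?b \<alpha>}) \<in> (SIGMA C:Pow P. {\<gamma>. partition_on (P - C) \<gamma>})"
      using B by auto
  qed
  finally show ?thesis by simp
qed

text \<open>Multiplying out the product colours each block with \<open>f\<close> or
  \<open>k\<close>; the blocks coloured \<open>f\<close> partition some \<open>M\<close>, the others
  \<open>N - M\<close>.\<close>

lemma partition_sum_add:
  assumes "finite N"
  shows "partition_sum (\<lambda>B. f B + k B) N = (\<Sum>M\<in>Pow N. partition_sum f M * partition_sum k (N - M))"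
proof -
  have fin: "finite L" if "L \<subseteq> N" for L
    using assms that finite_subset by blast
  have prt: "partition_on (\<Union>\<beta>) \<beta>" "partition_on (N - \<Union>\<beta>) (\<alpha> - \<beta>)" "\<Union>\<beta> \<subseteq> N"
    if "partition_on N \<alpha>" "\<beta> \<subseteq> \<alpha>" for \<alpha> \<beta>
  proof -
    note \<alpha> = partition_onD1[OF that(1)] partition_onD2[OF that(1)] partition_onD3[OF that(1)]
    have disj: "disjoint \<beta>" "disjoint (\<alpha> - \<beta>)"
      using \<alpha>(2) that(2) by (auto intro: pairwise_subset)
    show "partition_on (\<Union>\<beta>) \<beta>" "\<Union>\<beta> \<subseteq> N"
      using \<alpha> that(2) disj by (auto simp: partition_on_def)
    have "B \<inter> C = {}" if "B \<in> \<alpha> - \<beta>" "C \<in> \<beta>" for B C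
      using \<alpha>(2) \<open>\<beta> \<subseteq> \<alpha>\<close> that by (auto dest: disjointD)
    then have "\<Union>(\<alpha> - \<beta>) = \<Union>\<alpha> - \<Union>\<beta>"
      by (auto simp: disjoint_iff)
    then show "partition_on (N - \<Union>\<beta>) (\<alpha> - \<beta>)"
      using \<alpha> disj by (auto simp: partition_on_def)
  qed
  have un: "partition_on N (\<beta> \<union> \<gamma>)" "\<beta> \<inter> \<gamma> = {}" "\<Union>\<beta> = M"
    if "M \<subseteq> N" "partition_on M \<beta>" "partition_on (N - M) \<gamma>" for M \<beta> \<gamma>
  proof -
    note * = partition_onD1[OF that(2)] partition_onD3[OF that(2)]
      partition_onD1[OF that(3)] partition_onD3[OF that(3)]
    show "\<Union>\<beta> = M" using * by simp
    have disj: "B \<inter> C = {}" if "B \<in> \<beta>" "C \<in> \<gamma>" for B C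
      using * that by blast
    \<comment> \<open>A common block would be disjoint from itself, hence empty, and partitions have
      no empty block.\<close>
    show "\<beta> \<inter> \<gamma> = {}"
      using disj *(2) by (metis Int_iff equals0I inf.idem)
    have "disjoint (\<beta> \<union> \<gamma>)"
      using partition_onD2[OF that(2)] partition_onD2[OF that(3)] disj
      unfolding disjoint_def by (metis Int_commute Un_iff)
    moreover have "\<Union>(\<beta> \<union> \<gamma>) = N" using * that(1) by auto
    ultimately show "partition_on N (\<beta> \<union> \<gamma>)" using * by (auto simp: partition_on_def)
  qed
  have "partition_sum (\<lambda>B. f B + k B) N
    = (\<Sum>\<alpha> | partition_on N \<alpha>. \<Sum>\<beta>\<in>Pow \<alpha>. prod f \<beta> * prod k (\<alpha> - \<beta>))"
    unfolding partition_sum_def using assms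
    by (intro sum.cong refl prod_add) (auto intro: finite_elements)
  also have "\<dots> = (\<Sum>(\<alpha>, \<beta>)\<in>(SIGMA \<alpha>:{\<alpha>. partition_on N \<alpha>}. Pow \<alpha>). prod f \<beta> * prod k (\<alpha> - \<beta>))"
    using assms by (intro sum.Sigma) (auto intro: finite_elements finitely_many_partition_on)
  also have "\<dots> = (\<Sum>(M, \<beta>, \<gamma>)\<in>(SIGMA M:Pow N. {\<beta>. partition_on M \<beta>} \<times> {\<gamma>. partition_on (N - M) \<gamma>}).
      prod f \<beta> * prod k \<gamma>)"
  proof (rule sum.reindex_bij_witness[of _ "\<lambda>(M, \<beta>, \<gamma>). (\<beta> \<union> \<gamma>, \<beta>)" "\<lambda>(\<alpha>, \<beta>). (\<Union>\<beta>, \<beta>, \<alpha> - \<beta>)"],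
      goal_cases)
    case (3 p)
    then obtain M \<beta> \<gamma> where [simp]: "p = (M, \<beta>, \<gamma>)"
      and p: "M \<subseteq> N" "partition_on M \<beta>" "partition_on (N - M) \<gamma>" by auto
    have "\<beta> \<union> \<gamma> - \<beta> = \<gamma>" using un(2)[OF p] by blast
    with un(3)[OF p] show ?case by simp
  next
    case (4 p)
    then obtain M \<beta> \<gamma> where [simp]: "p = (M, \<beta>, \<gamma>)"
      and p: "M \<subseteq> N" "partition_on M \<beta>" "partition_on (N - M) \<gamma>" by auto
    with un(1)[OF p] show ?case by simp
  next
    case (2 p)
    then obtain \<alpha> \<beta> where [simp]: "p = (\<alpha>, \<beta>)" and p: "partition_on N \<alpha>" "\<beta> \<subseteq> \<alpha>" by auto
    show ?case using prt[OF p] by simp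
  qed auto
  also have "\<dots> = (\<Sum>M\<in>Pow N. \<Sum>(\<beta>, \<gamma>)\<in>{\<beta>. partition_on M \<beta>} \<times> {\<gamma>. partition_on (N - M) \<gamma>}.
      prod f \<beta> * prod k \<gamma>)"
    using assms fin by (intro sum.Sigma[symmetric] ballI finite_cartesian_product)
       (auto intro: finitely_many_partition_on)
  also have "\<dots> = (\<Sum>M\<in>Pow N. partition_sum f M * partition_sum k (N - M))"
    by (simp add: partition_sum_def sum_product sum.cartesian_product)
  finally show ?thesis .
qed

text \<open>The exponent is additive over disjoint blocks, so every partition acquires the same
  factor.\<close>

lemma partition_sum_exp_scale:
  assumes "finite N"
  shows "partition_sum (\<lambda>B. exp (c * sum x B) * f B) N = exp (c * sum x N) * partition_sum f N"
  unfolding partition_sum_def sum_distrib_left[of _ _ "{\<alpha>. partition_on N \<alpha>}"]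
proof (intro sum.cong refl)
  fix \<alpha> assume "\<alpha> \<in> {\<alpha>. partition_on N \<alpha>}"
  then have \<alpha>: "partition_on N \<alpha>" by simp
  have "finite \<alpha>" using finite_elements[OF assms \<alpha>] .
  have "(\<Sum>B\<in>\<alpha>. sum x B) = sum x (\<Union>\<alpha>)"
    using partition_onD1[OF \<alpha>] partition_onD2[OF \<alpha>] assms
    by (subst sum.Union_disjoint) (auto simp: disjoint_def intro: finite_subset)
  then have "(\<Prod>B\<in>\<alpha>. exp (c * sum x B)) = exp (c * sum x N)"
    using \<open>finite \<alpha>\<close> partition_onD1[OF \<alpha>] by (simp flip: exp_sum sum_distrib_left)
  then show "(\<Prod>B\<in>\<alpha>. exp (c * sum x B) * f B) = exp (c * sum x N) * prod f \<alpha>"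
    by (simp add: prod.distrib)
qed

lemma appell_power: "appell (\<lambda>k z. z ^ k)"
  unfolding appell_def by (auto intro!: derivative_eq_intros)

text \<open>Splitting off the block of one element \<open>m\<close> reduces the claim to Abel's
  identity for powers, with \<open>b = sum x M\<close>.\<close>

lemma partition_sum_hurwitz:
  assumes "finite M"
  shows "partition_sum (\<lambda>B. a * sum x B ^ (card B - 1)) M = hurwitz x M a"
  using assms
proof (induction M rule: finite_psubset_induct)
  case (psubset M)
  show ?case
  proof (cases "M = {}")
    case False
    then obtain m P where M: "M = insert m P" "m \<notin> P" by (meson ex_in_conv mk_disjoint_insert)
    with psubset.hyps have fin: "finite P" by simp
    have "partition_sum (\<lambda>B. a * sum x B ^ (card B - 1)) M
      = (\<Sum>C\<in>Pow P. a * (sum x (insert m C) ^ card C * hurwitz x (P - C) a))"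
      unfolding M partition_sum_insert[OF fin M(2)]
    proof (intro sum.cong refl)
      fix C assume C: "C \<in> Pow P"
      then have "finite C" "m \<notin> C" "P - C \<subset> M" using fin M by (auto intro: finite_subset)
      then have "partition_sum (\<lambda>B. a * sum x B ^ (card B - 1)) (P - C) = hurwitz x (P - C) a"
        by (intro psubset.IH) auto
      with \<open>finite C\<close> \<open>m \<notin> C\<close> show "a * sum x (insert m C) ^ (card (insert m C) - 1) *
        partition_sum (\<lambda>B. a * sum x B ^ (card B - 1)) (P - C)
        = a * (sum x (insert m C) ^ card C * hurwitz x (P - C) a)"
        by simp
    qed
    also have "\<dots> = a * (\<Sum>C\<in>Pow P. sum x (insert m C) ^ card C * hurwitz x (P - C) a)"
      by (simp add: sum_distrib_left)
    also have "(\<Sum>C\<in>Pow P. sum x (insert m C) ^ card C * hurwitz x (P - C) a)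
      = (\<Sum>C\<in>Pow P. hurwitz x C a * (sum x M - sum x C) ^ card (P - C))"
    \<comment> \<open>Passing to the complement of \<open>C\<close> in \<open>P\<close> gives the
      argument the form \<open>b - sum x C\<close>.\<close>
    proof (rule sum.reindex_bij_witness[of _ "\<lambda>C. P - C" "\<lambda>C. P - C"])
      fix C assume C: "C \<in> Pow P"
      then have "P - (P - C) = C" "finite C" "m \<notin> C" using fin M by (auto intro: finite_subset)
      moreover have "sum x (P - C) = sum x P - sum x C" using C fin by (simp add: sum_diff)
      ultimately show "hurwitz x (P - C) a * (sum x M - sum x (P - C)) ^ card (P - (P - C)) =
         sum x (insert m C) ^ card C * hurwitz x (P - C) a"
        using M fin by simp
    qed auto
    also have "\<dots> = (sum x M + a) ^ card P"
      by (rule abel_hurwitz[OF fin appell_power])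
    finally show ?thesis using False M fin by (simp add: hurwitz_def add.commute)
  qed simp
qed

subsection \<open>Derivatives of \<open>g\<close> and Hermite polynomials\<close>

text \<open>For nonzero \<open>h\<close>, the polynomial factor of the \<open>k\<close>-th
  derivative of \<open>exp (h * z\<^sup>2 / 2)\<close>, divided by \<open>h ^ k\<close>. The plus
  sign in the recursion reflects the sign of the exponent.\<close>

fun hermite :: "complex \<Rightarrow> nat \<Rightarrow> complex poly" where
  "hermite h 0 = 1"
| "hermite h (Suc k) = [:0, 1:] * hermite h k + Polynomial.smult (1 / h) (pderiv (hermite h k))"

lemma pderiv_hermite: "pderiv (hermite h k) = Polynomial.smult (of_nat k) (hermite h (k - 1))"
proof (induction k)
  case (Suc k)
  \<comment> \<open>By the induction hypothesis this is \<open>k\<close> times the recursion that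
    produces \<open>hermite h k\<close>; both sides vanish at \<open>k = 0\<close>.\<close>
  have "[:0, 1:] * pderiv (hermite h k) + Polynomial.smult (1 / h) (pderiv (pderiv (hermite h k)))
    = Polynomial.smult (of_nat k) (hermite h k)"
  proof (cases k)
    case (Suc j)
    show ?thesis
      unfolding \<open>pderiv (hermite h k) = _\<close> unfolding Suc diff_Suc_1 hermite.simps(2)[of h j]
      by (simp add: pderiv_smult smult_add_right mult.commute del: hermite.simps)
  qed (simp add: pderiv_1)
  then show ?case
    by (simp add: Suc.IH pderiv_add pderiv_mult pderiv_smult pderiv_pCons smult_add_left algebra_simps)
qed (simp add: pderiv_1)

text \<open>Abel's identity has arguments \<open>b - sum x M\<close>, whereas partial sums enter the
  recursion with a plus sign; hence the reflection. The sign \<open>(-1) ^ k\<close> keeps the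
  sequence Appell and is the one in the recursion.\<close>

lemma appell_hermite: "appell (\<lambda>k z. (-1) ^ k * poly (hermite h k) (- z))"
  unfolding appell_def
proof (intro allI)
  fix k z
  have "((\<lambda>z. (-1) ^ k * poly (hermite h k) (- z)) has_field_derivative
      (-1) ^ k * (poly (pderiv (hermite h k)) (- z) * (-1))) (at z)"
    by (intro DERIV_cmult DERIV_chain2[OF poly_DERIV]) (auto intro!: derivative_eq_intros)
  then show "((\<lambda>z. (-1) ^ k * poly (hermite h k) (- z)) has_field_derivative
      of_nat k * ((-1) ^ (k - 1) * poly (hermite h (k - 1)) (- z))) (at z)"
    by (cases k) (simp_all add: pderiv_hermite mult_ac del: hermite.simps(2))
qed

text \<open>The exponent has derivative \<open>h * (z + s / h)\<close>, so the product rule gives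
  \<open>h\<close> times the Hermite recursion at the shifted point.\<close>

lemma gaussian_hermite_deriv:
  assumes "h \<noteq> 0"
  shows "((\<lambda>z. exp (h * z\<^sup>2 / 2 + s * z) * poly (hermite h k) (z + s / h)) has_field_derivative
    h * (exp (h * z\<^sup>2 / 2 + s * z) * poly (hermite h (Suc k)) (z + s / h))) (at z)"
proof -
  have "((\<lambda>z. poly (hermite h k) (z + s / h)) has_field_derivative
      poly (pderiv (hermite h k)) (z + s / h) * 1) (at z)"
    by (intro DERIV_chain2[OF poly_DERIV]) (auto intro!: derivative_eq_intros)
  note P = this
  have "((\<lambda>z. exp (h * z\<^sup>2 / 2 + s * z)) has_field_derivative
      exp (h * z\<^sup>2 / 2 + s * z) * (h * z + s)) (at z)"
    by (auto intro!: derivative_eq_intros)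
  from DERIV_mult[OF this P] show ?thesis
    by (rule DERIV_cong) (use assms in \<open>simp add: field_simps\<close>)
qed

lemma scaled_taylor_coeff_hermite:
  assumes "h \<noteq> 0"
  shows "fact k * scaled_taylor_coeff h k z = exp (h * z\<^sup>2 / 2) *
    (exp (\<i> * pi * z) * poly (hermite h k) (z + \<i> * pi / h)
      - exp (- \<i> * pi * z) * poly (hermite h k) (z - \<i> * pi / h)) / (2 * \<i>)"
proof -
  \<comment> \<open>The sine splits \<open>g h\<close> into two such Gaussians, with
    \<open>s = \<i> * pi\<close> and \<open>s = - \<i> * pi\<close>.\<close>
  define E where "E s k z = exp (h * z\<^sup>2 / 2 + s * z) * poly (hermite h k) (z + s / h)" for s k z
  have E: "(E s k has_field_derivative h * E s (Suc k) z) (at z)" for s k z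
    unfolding E_def[abs_def] by (rule gaussian_hermite_deriv[OF assms])
  have "(deriv ^^ k) (g h) = (\<lambda>z. h ^ k * (E (\<i> * pi) k z - E (- \<i> * pi) k z) / (2 * \<i>))"
  proof (induction k)
    case 0
    have "E (\<i> * pi) 0 z = exp (h * z\<^sup>2 / 2) * exp (\<i> * (pi * z))"
      "E (- \<i> * pi) 0 z = exp (h * z\<^sup>2 / 2) * exp (- (\<i> * (pi * z)))" for z :: complex
      by (simp_all add: E_def mult.assoc flip: exp_add)
    then have "g h z = (E (\<i> * pi) 0 z - E (- \<i> * pi) 0 z) / (2 * \<i>)" for z
      unfolding g_def sin_exp_eq by (simp add: right_diff_distrib mult.commute)
    then show ?case by (simp add: fun_eq_iff)
  next
    case (Suc k)
    have "((\<lambda>z. h ^ k * (E (\<i> * pi) k z - E (- \<i> * pi) k z) / (2 * \<i>)) has_field_derivative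
      h ^ k * (h * E (\<i> * pi) (Suc k) z - h * E (- \<i> * pi) (Suc k) z) / (2 * \<i>)) (at z)" for z
      by (intro DERIV_cdivide DERIV_cmult DERIV_diff E)
    then show ?case
      by (auto simp: Suc fun_eq_iff algebra_simps intro!: DERIV_imp_deriv[THEN trans])
  qed
  then have "fact k * scaled_taylor_coeff h k z = (E (\<i> * pi) k z - E (- \<i> * pi) k z) / (2 * \<i>)"
    using assms by (simp add: scaled_taylor_coeff_def power_int_minus)
  then show ?thesis
    by (simp only: E_def exp_add distrib_left mult.assoc mult_minus_right minus_divide_left[symmetric]
        mult_minus_left diff_conv_add_uminus)
qed

section \<open>The recursion for the sums over set partitions\<close>

lemma hermite_partition_sum:
  assumes "finite N"
  shows "(\<Sum>L\<in>Pow N. (-1) ^ card (N - L) * poly (hermite h (card (N - L))) (sum x L + c)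
        * partition_sum (\<lambda>B. 2 * c * sum x B ^ (card B - 1) + r B) L)
    = (\<Sum>L\<in>Pow N. (-1) ^ card (N - L) * poly (hermite h (card (N - L))) (sum x L - c)
        * partition_sum r L)"
proof -
  define f where "f k z = (-1) ^ k * poly (hermite h k) (- z)" for k z
  have f: "appell f" unfolding f_def[abs_def] by (rule appell_hermite)
  have fin: "finite L" if "L \<subseteq> N" for L
    using assms that finite_subset by blast
  have "(\<Sum>L\<in>Pow N. (-1) ^ card (N - L) * poly (hermite h (card (N - L))) (sum x L + c)
        * partition_sum (\<lambda>B. 2 * c * sum x B ^ (card B - 1) + r B) L)
    = (\<Sum>L\<in>Pow N. f (card (N - L)) (- sum x L - c)
        * (\<Sum>M\<in>Pow L. hurwitz x M (2 * c) * partition_sum r (L - M)))"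
  proof (intro sum.cong refl)
    fix L assume "L \<in> Pow N"
    then have L: "finite L" using fin by auto
    \<comment> \<open>The blocks of the first weight sum up to a Hurwitz polynomial at
      \<open>2 * c\<close>.\<close>
    have "partition_sum (\<lambda>B. 2 * c * sum x B ^ (card B - 1) + r B) L
      = (\<Sum>M\<in>Pow L. hurwitz x M (2 * c) * partition_sum r (L - M))"
      unfolding partition_sum_add[OF L]
    proof (intro sum.cong refl)
      fix M assume "M \<in> Pow L"
      then have "finite M" using L finite_subset by auto
      from partition_sum_hurwitz[OF this]
      show "partition_sum (\<lambda>B. 2 * c * sum x B ^ (card B - 1)) M * partition_sum r (L - M)
        = hurwitz x M (2 * c) * partition_sum r (L - M)" by (rule arg_cong)
    qed
    then show "(-1) ^ card (N - L) * poly (hermite h (card (N - L))) (sum x L + c)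
        * partition_sum (\<lambda>B. 2 * c * sum x B ^ (card B - 1) + r B) L
      = f (card (N - L)) (- sum x L - c)
        * (\<Sum>M\<in>Pow L. hurwitz x M (2 * c) * partition_sum r (L - M))"
      by (simp add: f_def add.commute)
  qed
  also have "\<dots> = (\<Sum>L\<in>Pow N. \<Sum>M\<in>Pow L.
      hurwitz x M (2 * c) * f (card (N - (L - M) - M)) ((- sum x (L - M) - c) - sum x M)
        * partition_sum r (L - M))"
    unfolding sum_distrib_left
  proof (intro sum.cong refl)
    fix L M assume "L \<in> Pow N" "M \<in> Pow L"
    then have "N - (L - M) - M = N - L" "- sum x L - c = (- sum x (L - M) - c) - sum x M"
      using fin[of L] by (auto simp: sum.subset_diff[of M L])
    then show "f (card (N - L)) (- sum x L - c) * (hurwitz x M (2 * c) * partition_sum r (L - M))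
      = hurwitz x M (2 * c) * f (card (N - (L - M) - M)) ((- sum x (L - M) - c) - sum x M)
        * partition_sum r (L - M)"
      by (simp only: mult_ac)
  qed
  also have "\<dots> = (\<Sum>K\<in>Pow N. \<Sum>M\<in>Pow (N - K).
      hurwitz x M (2 * c) * f (card (N - K - M)) ((- sum x K - c) - sum x M) * partition_sum r K)"
    by (rule sum_Pow_Pow_diff[OF assms])
  \<comment> \<open>For fixed \<open>K\<close> the sum over \<open>M\<close> is Abel's identity with
    \<open>a = 2 * c\<close> and \<open>b = - sum x K - c\<close>; the new argument is
    \<open>-(sum x K - c)\<close>.\<close>
  also have "\<dots> = (\<Sum>K\<in>Pow N. f (card (N - K)) (- sum x K - c + 2 * c) * partition_sum r K)"
    by (simp only: sum_distrib_right[symmetric] abel_hurwitz[OF finite_Diff[OF assms] f])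
  finally show ?thesis
    by (simp add: f_def)
qed

text \<open>The Gaussian prefactors cancel, and the two exponentials of the sine are absorbed into
  the block weights; \<open>hermite_partition_sum\<close> with \<open>r B = v B * F B\<close> then
  equates the two halves.\<close>

lemma partition_sum_satisfies_recursion:
  assumes "finite N" "h \<noteq> 0"
    and sin: "\<And>B. B \<subseteq> N \<Longrightarrow> B \<noteq> {} \<Longrightarrow> sin (of_real pi * sum x B) \<noteq> 0"
  shows "(\<Sum>L\<in>Pow N. (-1) ^ card (N - L) *
      (fact (card (N - L)) * scaled_taylor_coeff h (card (N - L)) (sum x L)) *
      (exp (- (h / 2) * (sum x L)\<^sup>2) * partition_sum (\<lambda>B. S_block x B / h) L)) = 0"
proof -
  define F where "F B = S_block x B / h" for B
  define c where "c = \<i> * pi / h"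
  define u where "u B = exp (\<i> * pi * sum x B)" for B
  define v where "v B = exp (- \<i> * pi * sum x B)" for B
  have fin: "finite L" if "L \<subseteq> N" for L
    using assms that finite_subset by blast
  \<comment> \<open>The sine in the denominator of \<open>S_block\<close> is
    \<open>(u B - v B) / (2 * \<i>)\<close>, so the two weights differ by a polynomial.\<close>
  have uF: "u B * F B = 2 * c * sum x B ^ (card B - 1) + v B * F B" if "B \<subseteq> N" "B \<noteq> {}" for B
  proof -
    have s: "sin (of_real pi * sum x B) = (u B - v B) / (2 * \<i>)"
      by (simp add: sin_exp_eq u_def v_def mult.assoc)
    have "(u B - v B) * F B = 2 * c * sum x B ^ (card B - 1)"
      using sin[OF that] assms(2) unfolding F_def S_block_def c_def s
      by (simp add: field_simps)
    then show ?thesis by (simp add: algebra_simps)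
  qed
  have term_eq: "fact k * scaled_taylor_coeff h k (sum x L) * (exp (- (h / 2) * (sum x L)\<^sup>2) * partition_sum F L)
    = (poly (hermite h k) (sum x L + c) * partition_sum (\<lambda>B. 2 * c * sum x B ^ (card B - 1) + v B * F B) L
      - poly (hermite h k) (sum x L - c) * partition_sum (\<lambda>B. v B * F B) L) / (2 * \<i>)"
    if "L \<subseteq> N" for L k
  proof -
    have "u L * partition_sum F L = partition_sum (\<lambda>B. u B * F B) L"
      unfolding u_def by (rule partition_sum_exp_scale[OF fin[OF that], symmetric])
    also have "\<dots> = partition_sum (\<lambda>B. 2 * c * sum x B ^ (card B - 1) + v B * F B) L"
      using uF that by (intro partition_sum_cong) auto
    finally have 1: "partition_sum (\<lambda>B. 2 * c * sum x B ^ (card B - 1) + v B * F B) L = u L * partition_sum F L" ..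
    have 2: "partition_sum (\<lambda>B. v B * F B) L = v L * partition_sum F L"
      unfolding v_def by (rule partition_sum_exp_scale[OF fin[OF that]])
    have 3: "exp (h * (sum x L)\<^sup>2 / 2) * exp (- (h / 2) * (sum x L)\<^sup>2) = 1"
      by (simp add: exp_minus flip: exp_add)
    have "fact k * scaled_taylor_coeff h k (sum x L) * (exp (- (h / 2) * (sum x L)\<^sup>2) * partition_sum F L)
      = (exp (h * (sum x L)\<^sup>2 / 2) * exp (- (h / 2) * (sum x L)\<^sup>2)) *
        ((u L * poly (hermite h k) (sum x L + c) - v L * poly (hermite h k) (sum x L - c))
           * partition_sum F L / (2 * \<i>))"
      unfolding scaled_taylor_coeff_hermite[OF assms(2)] u_def v_def c_def by simp
    then show ?thesis unfolding 1 2 3 by (simp add: algebra_simps)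
  qed
  have "(\<Sum>L\<in>Pow N. (-1) ^ card (N - L) *
      (fact (card (N - L)) * scaled_taylor_coeff h (card (N - L)) (sum x L)) *
      (exp (- (h / 2) * (sum x L)\<^sup>2) * partition_sum F L))
    = (\<Sum>L\<in>Pow N. ((-1) ^ card (N - L) * poly (hermite h (card (N - L))) (sum x L + c)
        * partition_sum (\<lambda>B. 2 * c * sum x B ^ (card B - 1) + v B * F B) L
      - (-1) ^ card (N - L) * poly (hermite h (card (N - L))) (sum x L - c)
        * partition_sum (\<lambda>B. v B * F B) L) / (2 * \<i>))"
    by (intro sum.cong refl) (simp only: mult.assoc[of "(-1) ^ _"] term_eq Pow_iff, simp add: algebra_simps)
  also have "\<dots> = 0"
    by (simp only: sum_divide_distrib[symmetric] sum_subtractf hermite_partition_sum[OF assms(1)]) simp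
  finally show ?thesis unfolding F_def[abs_def] .
qed

subsection \<open>The determinants as sums over chains\<close>

text \<open>
  The recursion says that the vector \<open>v\<^sub>j = (-1)\<^bsup>j\<^esup> d(n - 1 - j)\<close> is mapped to a multiple of the first
  unit vector, so making it the last column of a unitriangular matrix leaves one Laplace term.
\<close>
lemma det_hessenberg_recursion:
  fixes c :: "nat \<Rightarrow> nat \<Rightarrow> 'a::field"
  assumes "n \<ge> 1" and d0: "d 0 = 1"
    and rec: "\<And>m. 1 \<le> m \<Longrightarrow> m \<le> n \<Longrightarrow> (\<Sum>k\<le>m. (-1) ^ k * c k (m - k) * d (m - k)) = 0"
  shows "Determinant.det (mat n n (\<lambda>(i, j). if j + 1 < i then 0 else c (j + 1 - i) (n - (j + 1))))
    = d n * (\<Prod>k = 1..n. c 0 k)"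
proof -
  obtain p where n: "n = Suc p" using assms(1) by (cases n) auto
  define M where "M = mat n n (\<lambda>(i, j). if j + 1 < i then 0 else c (j + 1 - i) (n - (j + 1)))"
  \<comment> \<open>The identity matrix with its last column replaced; \<open>d 0 = 1\<close> makes
    the corner entry \<open>(-1) ^ p\<close>.\<close>
  define U where "U = mat n n (\<lambda>(i, j). if j = p then (-1) ^ i * d (p - i) else if i = j then 1 else 0)"
  have M: "M \<in> carrier_mat n n" and U: "U \<in> carrier_mat n n"
    by (auto simp: M_def U_def)
  have "upper_triangular U" by (auto simp: U_def n)
  then have "Determinant.det U = (\<Prod>i = 0..<n. U $$ (i, i))"
    using U by (simp add: det_upper_triangular prod_list_diag_prod)
  also have "\<dots> = (-1) ^ p"
    by (simp add: n U_def d0)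
  finally have detU: "Determinant.det U = (-1) ^ p" .
  have entry: "(M * U) $$ (i, j) = (\<Sum>l<n. M $$ (i, l) * U $$ (l, j))" if "i < n" "j < n" for i j
    using that M U by (simp add: scalar_prod_def atLeast0LessThan)
  have left: "(M * U) $$ (i, j) = M $$ (i, j)" if "i < n" "j < p" for i j
  proof -
    have "(M * U) $$ (i, j) = (\<Sum>l<n. if l = j then M $$ (i, l) else 0)"
      unfolding entry[OF that(1) less_trans[OF that(2)], unfolded n, OF lessI, folded n] using that
      by (intro sum.cong refl) (auto simp: U_def n)
    then show ?thesis using that by (simp add: n)
  qed
  have last: "(M * U) $$ (i, p) = (if i = 0 then c 0 n * d n else 0)" if "i < n" for i
  proof -
    have eq: "(M * U) $$ (i, p) =
        (\<Sum>l\<le>p. (if l + 1 < i then 0 else c (l + 1 - i) (p - l)) * ((-1) ^ l * d (p - l)))"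
      unfolding entry[OF that, of p, unfolded n, OF lessI, folded n] lessThan_Suc_atMost[of p, folded n]
      using that by (intro sum.cong refl) (auto simp: U_def M_def n)
    show ?thesis
    proof (cases i)
      case 0
      \<comment> \<open>Row 0 has no subdiagonal entry, so of the recursion at \<open>m = n\<close>
        only the term \<open>k = 0\<close> is missing.\<close>
      have "c 0 n * d n = (\<Sum>l\<le>p. c (Suc l) (p - l) * ((-1) ^ l * d (p - l)))"
        using rec[of n] unfolding n sum.atMost_Suc_shift
        by (simp add: sum_negf mult_ac)
      then show ?thesis using 0 eq by simp
    next
      case (Suc i')
      \<comment> \<open>Row \<open>i = Suc i'\<close> carries the full recursion at
        \<open>m = n - i\<close>; its subdiagonal entry is the term \<open>k = 0\<close>.\<close>
      have "(\<Sum>l\<le>p. (if l + 1 < i then 0 else c (l + 1 - i) (p - l)) * ((-1) ^ l * d (p - l)))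
        = (\<Sum>l\<in>{i'..p}. c (l + 1 - i) (p - l) * ((-1) ^ l * d (p - l)))"
        using Suc by (intro sum.mono_neutral_cong_right) auto
      also have "\<dots> = (\<Sum>k\<le>p - i'. (-1) ^ i' * ((-1) ^ k * c k (p - i' - k) * d (p - i' - k)))"
        using Suc that n
        by (intro sum.reindex_bij_witness[of _ "\<lambda>k. k + i'" "\<lambda>l. l - i'"])
           (auto simp: power_add[symmetric])
      also have "\<dots> = 0"
        using rec[of "p - i'"] Suc that n by (simp add: sum_distrib_left[symmetric])
      finally show ?thesis using Suc eq by simp
    qed
  qed
  have entry_del: "mat_delete (M * U) 0 p $$ (i, j) = M $$ (Suc i, j)" if "i < p" "j < p" for i j
  proof -
    have "mat_delete (M * U) 0 p $$ (i, j) = (M * U) $$ (Suc i, j)"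
      using that M U by (simp add: mat_delete_def n)
    also have "\<dots> = M $$ (Suc i, j)"
      using that by (intro left) (auto simp: n)
    finally show ?thesis .
  qed
  \<comment> \<open>Deleting row 0 moves the subdiagonal entries \<open>c 0 (p - j)\<close> onto the
    diagonal.\<close>
  have "upper_triangular (mat_delete (M * U) 0 p)"
  proof (rule upper_triangularI)
    fix i j assume "j < i" "i < dim_row (mat_delete (M * U) 0 p)"
    moreover from this have "i < p" using M by (simp add: n)
    ultimately show "mat_delete (M * U) 0 p $$ (i, j) = 0"
      by (subst entry_del) (auto simp: M_def n)
  qed
  moreover have del: "mat_delete (M * U) 0 p \<in> carrier_mat p p"
    using M U by (auto simp: mat_delete_def n)
  ultimately have "Determinant.det (mat_delete (M * U) 0 p) = (\<Prod>j = 0..<p. mat_delete (M * U) 0 p $$ (j, j))"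
    using M by (simp add: n det_upper_triangular prod_list_diag_prod)
  also have "\<dots> = (\<Prod>j = 0..<p. c 0 (p - j))"
  proof (intro prod.cong refl)
    fix j assume "j \<in> {0..<p}"
    then show "mat_delete (M * U) 0 p $$ (j, j) = c 0 (p - j)"
      by (subst entry_del) (auto simp: M_def n)
  qed
  also have "\<dots> = (\<Prod>k = 1..p. c 0 k)"
    by (rule prod.reindex_bij_witness[of _ "\<lambda>k. p - k" "\<lambda>j. p - j"]) auto
  finally have cof: "cofactor (M * U) 0 p = (-1) ^ p * (\<Prod>k = 1..p. c 0 k)"
    by (simp add: cofactor_def)
  have "Determinant.det (M * U) = (\<Sum>i<n. (M * U) $$ (i, p) * cofactor (M * U) i p)"
    using M U by (intro laplace_expansion_column) (auto simp: n)
  also have "\<dots> = (\<Sum>i<n. if i = 0 then c 0 n * d n * cofactor (M * U) 0 p else 0)"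
    by (intro sum.cong) (auto simp: last)
  also have "\<dots> = c 0 n * d n * cofactor (M * U) 0 p"
    by (simp add: n)
  finally have "Determinant.det M * (-1) ^ p = (d n * (\<Prod>k = 1..n. c 0 k)) * (-1) ^ p"
    using det_mult[OF M U] detU cof by (simp add: n prod.atLeast1_atMost_eq mult_ac)
  then show ?thesis by (simp add: M_def)
qed

text \<open>
  The list is in reverse order: its head is the last variable of the chain, and \<open>drop k\<close> removes the
  last \<open>k\<close> variables.
\<close>
function chain_weight :: "(nat \<Rightarrow> complex \<Rightarrow> complex) \<Rightarrow> ('a \<Rightarrow> complex) \<Rightarrow> 'a list \<Rightarrow> complex" where
  "chain_weight c x [] = 1"
| "chain_weight c x (a # ys) =
    (\<Sum>k\<le>length ys. (-1) ^ k * c (Suc k) (sum_list (map x (drop k ys))) * chain_weight c x (drop k ys))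
      / c 0 (sum_list (map x (a # ys)))"
  by pat_completeness auto
termination
  by (relation "Wellfounded.measure (\<lambda>(c, x, ys). length ys)") auto

text \<open>The defining equation with its denominator cleared; the left side becomes the term
  \<open>k = 0\<close>.\<close>

lemma chain_weight_recursion:
  assumes "ys \<noteq> []" "c 0 (sum_list (map x ys)) \<noteq> 0"
  shows "(\<Sum>k\<le>length ys. (-1) ^ k * c k (sum_list (map x (drop k ys))) * chain_weight c x (drop k ys)) = 0"
proof -
  obtain a zs where ys: "ys = a # zs" using assms(1) by (cases ys) auto
  have "c 0 (sum_list (map x ys)) * chain_weight c x ys =
    (\<Sum>k\<le>length zs. (-1) ^ k * c (Suc k) (sum_list (map x (drop k zs))) * chain_weight c x (drop k zs))"
    using assms(2) by (simp add: ys)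
  then show ?thesis
    unfolding ys length_Cons sum.atMost_Suc_shift by (simp add: sum_negf del: chain_weight.simps)
qed

section \<open>Symmetrisation over all orderings\<close>

lemma sum_permutations_drop:
  fixes F :: "'a list \<Rightarrow> complex"
  assumes "finite N" "k \<le> card N"
  shows "(\<Sum>ys\<in>permutations_of_set N. F (drop k ys)) =
    fact k * (\<Sum>L\<in>{L\<in>Pow N. card (N - L) = k}. \<Sum>zs\<in>permutations_of_set L. F zs)"
  using assms
proof (induction k arbitrary: N)
  case 0
  then have "{L\<in>Pow N. card (N - L) = 0} = {N}" by auto
  then show ?case by simp
next
  case (Suc k)
  then have "N \<noteq> {}" by auto
  \<comment> \<open>The first entry \<open>a\<close> is always dropped, so the surviving set
    \<open>L\<close> avoids it.\<close>
  have "(\<Sum>ys\<in>permutations_of_set N. F (drop (Suc k) ys))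
    = (\<Sum>a\<in>N. \<Sum>ys\<in>(#) a ` permutations_of_set (N - {a}). F (drop (Suc k) ys))"
    unfolding permutations_of_set_nonempty[OF \<open>N \<noteq> {}\<close>] using Suc.prems
    by (intro sum.UNION_disjoint) auto
  also have "\<dots> = (\<Sum>a\<in>N. \<Sum>ys\<in>permutations_of_set (N - {a}). F (drop k ys))"
    by (simp add: sum.reindex)
  also have "\<dots> = (\<Sum>a\<in>N. fact k * (\<Sum>L\<in>{L\<in>{L\<in>Pow N. card (N - L) = Suc k}. a \<notin> L}.
      \<Sum>zs\<in>permutations_of_set L. F zs))"
  proof (intro sum.cong refl)
    fix a assume a: "a \<in> N"
    have "card (N - {a} - L) = k \<longleftrightarrow> card (N - L) = Suc k" if "a \<notin> L" for L
    proof -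
      have "N - L = insert a (N - {a} - L)" using a that by auto
      then have "card (N - L) = Suc (card (N - {a} - L))" using Suc.prems by simp
      then show ?thesis by simp
    qed
    then have "{L\<in>Pow (N - {a}). card (N - {a} - L) = k} = {L\<in>{L\<in>Pow N. card (N - L) = Suc k}. a \<notin> L}"
      by auto
    then show "(\<Sum>ys\<in>permutations_of_set (N - {a}). F (drop k ys)) =
      fact k * (\<Sum>L\<in>{L\<in>{L\<in>Pow N. card (N - L) = Suc k}. a \<notin> L}. \<Sum>zs\<in>permutations_of_set L. F zs)"
      using Suc.prems a by (subst Suc.IH) auto
  qed
  \<comment> \<open>Each \<open>L\<close> is reached from the \<open>k + 1\<close> elements
    \<open>a\<close> of \<open>N - L\<close>, which turns \<open>fact k\<close> into
    \<open>fact (Suc k)\<close>.\<close>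
  also have "\<dots> = fact k * (\<Sum>L\<in>{L\<in>Pow N. card (N - L) = Suc k}. \<Sum>a\<in>{a\<in>N. a \<notin> L}.
      \<Sum>zs\<in>permutations_of_set L. F zs)"
    using Suc.prems by (subst sum.swap_restrict[symmetric]) (auto simp: sum_distrib_left)
  also have "\<dots> = fact (Suc k) * (\<Sum>L\<in>{L\<in>Pow N. card (N - L) = Suc k}.
      \<Sum>zs\<in>permutations_of_set L. F zs)"
    by (simp add: set_diff_eq[symmetric] sum_distrib_left[symmetric] sum_distrib_right[symmetric] mult_ac)
  finally show ?case .
qed

text \<open>The dropped entries can be ordered in \<open>fact (card (N - L))\<close> ways; for
  \<open>c = scaled_taylor_coeff h\<close> this cancels the factorial in the denominator.\<close>

lemma sum_chain_weight_recursion: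
  assumes "finite N" "N \<noteq> {}" "c 0 (sum x N) \<noteq> 0"
  shows "(\<Sum>L\<in>Pow N. (-1) ^ card (N - L) * (fact (card (N - L)) * c (card (N - L)) (sum x L)) *
    (\<Sum>zs\<in>permutations_of_set L. chain_weight c x zs)) = 0"
proof -
  define R where "R L = (\<Sum>zs\<in>permutations_of_set L. chain_weight c x zs)" for L
  have sum_list: "sum_list (map x ys) = sum x L" if "ys \<in> permutations_of_set L" for ys L
    using permutations_of_setD[OF that] by (auto simp: sum_list_distinct_conv_sum_set)
  define G where "G k zs = (-1) ^ k * c k (sum_list (map x zs)) * chain_weight c x zs" for k zs
  have "0 = (\<Sum>ys\<in>permutations_of_set N. \<Sum>k\<le>card N. G k (drop k ys))"
  proof (intro sum.neutral[symmetric] ballI)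
    fix ys assume ys: "ys \<in> permutations_of_set N"
    then have "length ys = card N" "ys \<noteq> []" "c 0 (sum_list (map x ys)) \<noteq> 0"
      using assms sum_list[OF ys] permutations_of_setD(1)[OF ys]
      by (auto simp: length_finite_permutations_of_set)
    then show "(\<Sum>k\<le>card N. G k (drop k ys)) = 0"
      using chain_weight_recursion[of ys c x] by (simp add: G_def)
  qed
  also have "\<dots> = (\<Sum>k\<le>card N. \<Sum>ys\<in>permutations_of_set N. G k (drop k ys))"
    by (rule sum.swap)
  also have "\<dots> = (\<Sum>k\<le>card N. \<Sum>L\<in>{L\<in>Pow N. card (N - L) = k}.
      (-1) ^ card (N - L) * (fact (card (N - L)) * c (card (N - L)) (sum x L)) * R L)"
  proof (intro sum.cong refl)
    fix k assume "k \<in> {..card N}"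
    then have "(\<Sum>ys\<in>permutations_of_set N. G k (drop k ys)) =
       fact k * (\<Sum>L\<in>{L\<in>Pow N. card (N - L) = k}. \<Sum>zs\<in>permutations_of_set L. G k zs)"
      using assms by (intro sum_permutations_drop) auto
    also have "\<dots> = (\<Sum>L\<in>{L\<in>Pow N. card (N - L) = k}.
      (-1) ^ card (N - L) * (fact (card (N - L)) * c (card (N - L)) (sum x L)) * R L)"
      unfolding sum_distrib_left R_def
      by (intro sum.cong refl) (auto simp: G_def sum_list)
    finally show "(\<Sum>ys\<in>permutations_of_set N. G k (drop k ys)) = \<dots>" .
  qed
  also have "\<dots> = (\<Sum>L\<in>Pow N. (-1) ^ card (N - L) * (fact (card (N - L)) * c (card (N - L)) (sum x L)) * R L)"
    using assms(1) by (intro sum.group) (auto intro: card_mono)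
  finally show ?thesis by (simp add: R_def)
qed

section \<open>Uniqueness of the solution and conclusion\<close>

lemma subset_recursion_unique:
  fixes R R' :: "'a set \<Rightarrow> complex"
  assumes "finite N"
    and "R {} = R' {}"
    and c0: "\<And>L. L \<subseteq> N \<Longrightarrow> L \<noteq> {} \<Longrightarrow> c 0 L \<noteq> 0"
    and "\<And>L. L \<subseteq> N \<Longrightarrow> L \<noteq> {} \<Longrightarrow> (\<Sum>K\<in>Pow L. c (card (L - K)) K * R K) = 0"
    and "\<And>L. L \<subseteq> N \<Longrightarrow> L \<noteq> {} \<Longrightarrow> (\<Sum>K\<in>Pow L. c (card (L - K)) K * R' K) = 0"
  shows "R N = R' N"
proof -
  have "R L = R' L" if "L \<subseteq> N" for L
    using finite_subset[OF that assms(1)] that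
  proof (induction L rule: finite_psubset_induct)
    case (psubset L)
    show ?case
    proof (cases "L = {}")
      case False
      \<comment> \<open>The nonzero leading coefficient \<open>c 0 L\<close> makes the value at
        \<open>L\<close> a function of the values at proper subsets.\<close>
      have split: "(\<Sum>K\<in>Pow L. c (card (L - K)) K * Q K) =
          c 0 L * Q L + (\<Sum>K\<in>Pow L - {L}. c (card (L - K)) K * Q K)" for Q
        using psubset.hyps by (subst sum.remove[of _ L]) auto
      have "(\<Sum>K\<in>Pow L - {L}. c (card (L - K)) K * R K) = (\<Sum>K\<in>Pow L - {L}. c (card (L - K)) K * R' K)"
        using psubset by (intro sum.cong refl arg_cong2[where f = times] psubset.IH) auto
      then have "c 0 L * R L = c 0 L * R' L"
        using assms(4,5)[of L] False psubset.prems unfolding split by (metis add_right_cancel)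
      then show ?thesis using c0 False psubset.prems by simp
    qed (use assms in simp)
  qed
  then show ?thesis by simp
qed

text \<open>Permutations fix all points outside the list, which gives injectivity; surjectivity
  follows by counting.\<close>

lemma bij_betw_permutations_of_set:
  assumes "distinct xs"
  shows "bij_betw (\<lambda>w. map w xs) {w. w permutes set xs} (permutations_of_set (set xs))"
proof -
  have inj: "inj_on (\<lambda>w. map w xs) {w. w permutes set xs}"
  proof (rule inj_onI)
    fix v w assume vw: "v \<in> {w. w permutes set xs}" "w \<in> {w. w permutes set xs}" "map v xs = map w xs"
    show "v = w"
    proof
      fix a show "v a = w a"
        using vw by (cases "a \<in> set xs") (auto simp: permutes_not_in)
    qed
  qed
  have "(\<lambda>w. map w xs) ` {w. w permutes set xs} \<subseteq> permutations_of_set (set xs)"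
    using assms by (auto simp: permutes_image distinct_map permutes_inj_on intro!: permutations_of_setI)
  moreover have "card ((\<lambda>w. map w xs) ` {w. w permutes set xs}) = card (permutations_of_set (set xs))"
    by (simp add: card_image[OF inj] card_permutations)
  ultimately have "(\<lambda>w. map w xs) ` {w. w permutes set xs} = permutations_of_set (set xs)"
    by (intro card_subset_eq) auto
  with inj show ?thesis by (simp add: bij_betw_def)
qed

text \<open>As \<open>scaled_taylor_coeff h 0\<close> is \<open>g h\<close>, the product in
  \<open>det_hessenberg_recursion\<close> is the denominator of the summand, and one chain weight
  remains.\<close>

lemma A_fun_eq_sum_chain_weight:
  assumes "n \<ge> 1"
    and nz: "\<And>I. I \<subseteq> {1..n} \<Longrightarrow> I \<noteq> {} \<Longrightarrow> g h (sum x I) \<noteq> 0"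
  shows "A_fun h n x = (\<Sum>zs\<in>permutations_of_set {1..n}. chain_weight (scaled_taylor_coeff h) x zs)"
proof -
  let ?D = "chain_weight (scaled_taylor_coeff h) x"
  have c0: "scaled_taylor_coeff h 0 = g h" by (simp add: scaled_taylor_coeff_def fun_eq_iff)
  have "Determinant.det (A_matrix h n x w) / (\<Prod>k = 1..n. g h (\<Sum>m = 1..k. x (w m)))
    = ?D (map w (rev [1..<Suc n]))" if w: "w permutes {1..n}" for w
  proof -
    \<comment> \<open>In reverse order, \<open>drop k\<close> discards the latest variables and
      turns \<open>ys m\<close> into \<open>ys (m - k)\<close>.\<close>
    define ys where "ys m = map w (rev [1..<Suc m])" for m
    have drop_ys: "drop k (ys m) = ys (m - k)" for k m
    proof -
      have "drop k (rev [1..<Suc m]) = rev (take (m - k) [1..<Suc m])"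
        by (simp add: drop_rev del: upt_Suc)
      also have "take (m - k) [1..<Suc m] = [1..<Suc (m - k)]"
        by (simp add: take_upt del: upt_Suc)
      finally show ?thesis unfolding ys_def drop_map by simp
    qed
    have sum_ys: "sum_list (map x (ys m)) = (\<Sum>i = 1..m. x (w i))" for m
    proof -
      have "sum_list (map x (ys m)) = sum_list (map (\<lambda>i. x (w i)) [1..<Suc m])"
        by (simp add: ys_def rev_map[symmetric] sum_list_rev comp_def del: upt_Suc)
      also have "\<dots> = (\<Sum>i = 1..m. x (w i))"
        by (simp add: sum_list_distinct_conv_sum_set atLeastLessThanSuc_atLeastAtMost del: upt_Suc)
      finally show ?thesis .
    qed
    have gnz: "g h (\<Sum>i = 1..m. x (w i)) \<noteq> 0" if "1 \<le> m" "m \<le> n" for m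
    proof -
      have "(\<Sum>i = 1..m. x (w i)) = sum x (w ` {1..m})"
        by (subst sum.reindex) (use permutes_inj_on[OF w] in auto)
      moreover have "w ` {1..m} \<subseteq> {1..n}"
        using permutes_image[OF w] that by (metis atLeastatMost_subset_iff image_mono order_refl)
      ultimately show ?thesis using nz[of "w ` {1..m}"] that by auto
    qed
    have "Determinant.det (A_matrix h n x w) =
        ?D (ys n) * (\<Prod>k = 1..n. scaled_taylor_coeff h 0 (\<Sum>i = 1..k. x (w i)))"
      unfolding A_matrix_def
    proof (rule det_hessenberg_recursion[OF assms(1),
          where c = "\<lambda>k m. scaled_taylor_coeff h k (\<Sum>i = 1..m. x (w i))" and d = "\<lambda>m. ?D (ys m)"])
      show "?D (ys 0) = 1" by (simp add: ys_def)
      fix m assume m: "1 \<le> m" "m \<le> n"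
      then have "ys m \<noteq> []" "length (ys m) = m" by (auto simp: ys_def)
      then show "(\<Sum>k\<le>m. (-1) ^ k * scaled_taylor_coeff h k (\<Sum>i = 1..m - k. x (w i)) * ?D (ys (m - k))) = 0"
        using chain_weight_recursion[of "ys m" "scaled_taylor_coeff h" x] gnz[OF m]
        by (simp add: drop_ys sum_ys c0)
    qed
    then show ?thesis using gnz by (simp add: c0 ys_def)
  qed
  then have "A_fun h n x = (\<Sum>w | w permutes {1..n}. ?D (map w (rev [1..<Suc n])))"
    by (simp add: A_fun_def del: upt_Suc)
  \<comment> \<open>The reversed lists also run through every ordering exactly once.\<close>
  also have "\<dots> = (\<Sum>zs\<in>permutations_of_set {1..n}. ?D zs)"
    using sum.reindex_bij_betw[OF bij_betw_permutations_of_set[of "rev [1..<Suc n]"], of ?D]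
    by (simp add: atLeastLessThanSuc_atLeastAtMost del: upt_Suc)
  finally show ?thesis .
qed

theorem theorem4p7:
  fixes h :: complex and n :: nat and x :: "nat \<Rightarrow> complex"
  assumes "n \<ge> 1"
    and "h \<noteq> 0"
    and "\<And>I. I \<subseteq> {1..n} \<Longrightarrow> I \<noteq> {} \<Longrightarrow> (\<Sum>i\<in>I. x i) \<notin> \<int>"
  shows "A_fun h n x =
           exp (- (h / 2) * (\<Sum>i = 1..n. x i)\<^sup>2) *
           (\<Sum>\<alpha> | partition_on {1..n} \<alpha>. h powi (- int (card \<alpha>)) * S_part x \<alpha>)"
proof -
  define N where "N = {1..n}"
  have sin: "sin (of_real pi * sum x I) \<noteq> 0" if "I \<subseteq> N" "I \<noteq> {}" for I
  proof
    assume "sin (of_real pi * sum x I) = 0"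
    then obtain m :: int where "of_real pi * sum x I = of_real (of_int m * pi)"
      unfolding sin_eq_0 by blast
    then have "sum x I = of_int m" by simp
    then show False using assms(3)[of I] that by (simp add: N_def)
  qed
  then have gnz: "g h (sum x I) \<noteq> 0" if "I \<subseteq> N" "I \<noteq> {}" for I
    using that by (simp add: g_def)
  \<comment> \<open>The common coefficients of the recursion for \<open>R\<close> and
    \<open>R'\<close>, with sign and factorial included.\<close>
  define c where "c k K = (-1) ^ k * (fact k * scaled_taylor_coeff h k (sum x K))" for k and K :: "nat set"
  define R where "R L = (\<Sum>zs\<in>permutations_of_set L. chain_weight (scaled_taylor_coeff h) x zs)" for L
  define R' where "R' L = exp (- (h / 2) * (sum x L)\<^sup>2) * partition_sum (\<lambda>B. S_block x B / h) L" for L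
  have c0: "c 0 L = g h (sum x L)" for L
    by (simp add: c_def scaled_taylor_coeff_def)
  have fin: "finite L" if "L \<subseteq> N" for L
    using that by (auto simp: N_def intro: finite_subset)
  have "A_fun h n x = R N"
    unfolding R_def N_def using gnz by (intro A_fun_eq_sum_chain_weight assms) (auto simp: N_def)
  also have "R N = R' N"
  proof (rule subset_recursion_unique[where c = c])
    fix L assume L: "L \<subseteq> N" "L \<noteq> {}"
    show "c 0 L \<noteq> 0" using gnz L by (simp add: c0)
    show "(\<Sum>K\<in>Pow L. c (card (L - K)) K * R K) = 0"
      unfolding c_def R_def using gnz[OF L] fin L
      by (intro sum_chain_weight_recursion) (auto simp: scaled_taylor_coeff_def)
    show "(\<Sum>K\<in>Pow L. c (card (L - K)) K * R' K) = 0"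
      unfolding c_def R'_def using sin L
      by (intro partition_sum_satisfies_recursion fin assms) auto
  qed (simp_all add: R_def R'_def N_def)
  \<comment> \<open>One factor \<open>1 / h\<close> per block gives the power with exponent
    \<open>- card \<alpha>\<close>.\<close>
  also have "partition_sum (\<lambda>B. S_block x B / h) N =
      (\<Sum>\<alpha> | partition_on N \<alpha>. h powi (- int (card \<alpha>)) * S_part x \<alpha>)"
    unfolding partition_sum_def S_part_def
    by (intro sum.cong refl) (simp add: prod_dividef power_int_minus field_simps)
  then have "R' N = exp (- (h / 2) * (sum x N)\<^sup>2) *
      (\<Sum>\<alpha> | partition_on N \<alpha>. h powi (- int (card \<alpha>)) * S_part x \<alpha>)"
    by (simp add: R'_def)
  finally show ?thesis by (simp add: N_def)
qed

end
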